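(* Let $\rho_\pm>0$, $\rho_-\neq\rho_+$, and $u_-<u_+$. For $\epsilon_1>0$ with $2\epsilon_1\le\rho_\pm$, let $(\rho^{\epsilon_1},u^{\epsilon_1})(t,x)=(\rho^{\epsilon_1},u^{\epsilon_1})(\xi)$, $\xi=x/t$, be the constant density solution $$(\rho^{\epsilon_1},u^{\epsilon_1})(\xi)=\begin{cases}(\rho_-,u_-),&-\infty<\xi<u_-,\\(2\epsilon_1,\xi),&u_-\le\xi\le u_+,\\(\rho_+,u_+),&u_+<\xi<+\infty,\end{cases}$$ of the Riemann problem for $$\rho_t+(\rho u-2\epsilon_1u)_x=0,\qquad(\rho u)_t+(\rho u^2-\epsilon_1u^2)_x=0$$ with data $(\rho_-,u_-)$ for $x<0$ and $(\rho_+,u_+)$ for $x>0$. Then, as $\epsilon_1\to0$, $(\rho^{\epsilon_1},u^{\epsilon_1})$ converges to the vacuum solution $$(\rho,u)(\xi)=\begin{cases}(\rho_-,u_-),&-\infty<\xi<u_-,\\(0,\xi),&u_-\le\xi\le u_+,\\(\rho_+,u_+),&u_+<\xi<+\infty,\end{cases}$$ of the Riemann problem with the same data for the zero-pressure system $\rho_t+(\rho u)_x=0$, $(\rho u)_t+(\rho u^2)_x=0$.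
   Context: Solutions are understood as self-similar weak (distributional) solutions for $t>0$ of the respective systems, and convergence is pointwise in $\xi$. *)

theory Defs
  imports "HOL-Analysis.Analysis"
begin

text \<open>Points of the plane are pairs \<open>(t, x)\<close>.\<close>

abbreviation upper_half_plane :: "(real \<times> real) set" where
  "upper_half_plane \<equiv> {0<..} \<times> UNIV"

text \<open>Functions of class \<open>C\<^sup>k\<close>: differentiable, with every directional derivative of class
  \<open>C\<^sup>k\<^sup>-\<^sup>1\<close>.\<close>

fun C_k :: "nat \<Rightarrow> (real \<times> real \<Rightarrow> real) \<Rightarrow> bool" where
  "C_k 0 \<phi> \<longleftrightarrow> continuous_on UNIV \<phi>"
| "C_k (Suc k) \<phi> \<longleftrightarrow>
     (\<forall>p. \<phi> differentiable (at p)) \<and>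
     (\<forall>v. C_k k (\<lambda>p. frechet_derivative \<phi> (at p) v))"

definition test_function :: "(real \<times> real \<Rightarrow> real) \<Rightarrow> bool" where
  "test_function \<phi> \<longleftrightarrow>
     (\<forall>k. C_k k \<phi>) \<and>
     compact (closure {p. \<phi> p \<noteq> 0}) \<and>
     closure {p. \<phi> p \<noteq> 0} \<subseteq> upper_half_plane"

definition dt :: "(real \<times> real \<Rightarrow> real) \<Rightarrow> real \<times> real \<Rightarrow> real" where
  "dt \<phi> p = frechet_derivative \<phi> (at p) (1, 0)"

definition dx :: "(real \<times> real \<Rightarrow> real) \<Rightarrow> real \<times> real \<Rightarrow> real" where
  "dx \<phi> p = frechet_derivative \<phi> (at p) (0, 1)"

definition locally_integrable :: "(real \<times> real \<Rightarrow> real) \<Rightarrow> bool" where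
  "locally_integrable f \<longleftrightarrow>
     (\<forall>K. compact K \<and> K \<subseteq> upper_half_plane \<longrightarrow> set_integrable lborel K f)"

text \<open>The equation \<open>g\<^sub>t + f\<^sub>x = 0\<close> for \<open>t > 0\<close> in the sense of distributions. Local
  integrability is required explicitly, since the integral of a non-integrable function is
  \<open>0\<close> by convention.\<close>

definition conservation_law ::
    "(real \<times> real \<Rightarrow> real) \<Rightarrow> (real \<times> real \<Rightarrow> real) \<Rightarrow> bool" where
  "conservation_law g f \<longleftrightarrow>
     locally_integrable g \<and> locally_integrable f \<and>
     (\<forall>\<phi>. test_function \<phi> \<longrightarrow>
        (LINT p:upper_half_plane|lborel. g p * dt \<phi> p + f p * dx \<phi> p) = 0)"

definition perturbed_system ::
    "real \<Rightarrow> (real \<times> real \<Rightarrow> real) \<Rightarrow> (real \<times> real \<Rightarrow> real) \<Rightarrow> bool" where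
  "perturbed_system \<epsilon> \<rho> u \<longleftrightarrow>
     conservation_law \<rho> (\<lambda>p. \<rho> p * u p - 2 * \<epsilon> * u p) \<and>
     conservation_law (\<lambda>p. \<rho> p * u p) (\<lambda>p. \<rho> p * (u p)\<^sup>2 - \<epsilon> * (u p)\<^sup>2)"

definition zero_pressure_system ::
    "(real \<times> real \<Rightarrow> real) \<Rightarrow> (real \<times> real \<Rightarrow> real) \<Rightarrow> bool" where
  "zero_pressure_system \<rho> u \<longleftrightarrow>
     conservation_law \<rho> (\<lambda>p. \<rho> p * u p) \<and>
     conservation_law (\<lambda>p. \<rho> p * u p) (\<lambda>p. \<rho> p * (u p)\<^sup>2)"

text \<open>The initial data are attained pointwise as \<open>t\<close> decreases to \<open>0\<close>, away from the jump of
  the data at \<open>x = 0\<close>; for self-similar functions this is the boundary condition at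
  \<open>\<xi> = \<plusminus>\<infinity>\<close>.\<close>

definition riemann_data :: "(real \<times> real \<Rightarrow> real) \<Rightarrow> real \<Rightarrow> real \<Rightarrow> bool" where
  "riemann_data w w\<^sub>l w\<^sub>r \<longleftrightarrow>
     (\<forall>x<0. ((\<lambda>t. w (t, x)) \<longlongrightarrow> w\<^sub>l) (at_right 0)) \<and>
     (\<forall>x>0. ((\<lambda>t. w (t, x)) \<longlongrightarrow> w\<^sub>r) (at_right 0))"

definition self_similar :: "(real \<Rightarrow> real) \<Rightarrow> real \<times> real \<Rightarrow> real" where
  "self_similar W = (\<lambda>(t, x). W (x / t))"

text \<open>A system is a predicate on the pair of unknowns; states are pairs (density, velocity),
  and \<open>w\<close> is a function of \<open>\<xi> = x / t\<close>.\<close>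

definition riemann_solution ::
    "((real \<times> real \<Rightarrow> real) \<Rightarrow> (real \<times> real \<Rightarrow> real) \<Rightarrow> bool) \<Rightarrow>
     real \<times> real \<Rightarrow> real \<times> real \<Rightarrow> (real \<Rightarrow> real \<times> real) \<Rightarrow> bool" where
  "riemann_solution sys l r w \<longleftrightarrow>
     (let \<rho> = self_similar (\<lambda>\<xi>. fst (w \<xi>)); u = self_similar (\<lambda>\<xi>. snd (w \<xi>))
      in sys \<rho> u \<and> riemann_data \<rho> (fst l) (fst r) \<and> riemann_data u (snd l) (snd r))"

definition constant_density_solution ::
    "real \<times> real \<Rightarrow> real \<times> real \<Rightarrow> real \<Rightarrow> real \<Rightarrow> real \<times> real" where
  "constant_density_solution l r \<epsilon> \<xi> =
     (if \<xi> < snd l then l else if \<xi> \<le> snd r then (2 * \<epsilon>, \<xi>) else r)"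

definition vacuum_solution ::
    "real \<times> real \<Rightarrow> real \<times> real \<Rightarrow> real \<Rightarrow> real \<times> real" where
  "vacuum_solution l r \<xi> =
     (if \<xi> < snd l then l else if \<xi> \<le> snd r then (0, \<xi>) else r)"

end

theory Submission
  imports Defs
begin

text \<open>
  Both systems consist of equations \<open>g\<^sub>t + f\<^sub>x = 0\<close>. For self-similar \<open>g = G(x/t)\<close> and
  \<open>f = F(x/t)\<close> such an equation is formally \<open>F' = \<xi> G'\<close>, that is \<open>K' = G\<close> for
  \<open>K(\<xi>) = \<xi> G(\<xi>) - F(\<xi>)\<close>. The second form makes sense when \<open>G\<close> and \<open>F\<close> jump: at a point \<open>\<xi>\<close>
  the function \<open>K\<close> is continuous exactly when the one-sided limits satisfy the Rankine-Hugoniot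
  condition for the speed \<open>\<xi>\<close>. Accordingly, continuity of \<open>K\<close> together with \<open>K' = G\<close> off a
  finite set suffices for the distributional equation (\<open>conservation_law_self_similar\<close>).

  For a test function \<open>\<phi>\<close> put \<open>\<psi>(t, \<xi>) = \<phi>(t, t \<xi>)\<close>, so that \<open>\<psi>\<^sub>t = \<phi>\<^sub>t + \<xi> \<phi>\<^sub>x\<close> and
  \<open>\<psi>\<^sub>\<xi> = t \<phi>\<^sub>x\<close>. Substituting \<open>x = t \<xi>\<close>, for fixed \<open>t\<close>, in the integral of
  \<open>g \<phi>\<^sub>t + f \<phi>\<^sub>x\<close> gives the integral over \<open>\<xi>\<close> of
  \<open>t G \<psi>\<^sub>t - K \<psi>\<^sub>\<xi> = G (t \<psi>)\<^sub>t - (K \<psi>)\<^sub>\<xi>\<close>. The last term integrates to \<open>0\<close> over \<open>\<xi>\<close>, and,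
  after exchanging the order of integration, the first one integrates to \<open>0\<close> over \<open>t\<close>. Only
  first derivatives of \<open>\<phi>\<close> are involved.

  For the constant density solution, \<open>K\<close> consists of three smooth pieces. On the middle one
  \<open>(G, F)\<close> is \<open>(2 \<epsilon>, 0)\<close> in the first equation and \<open>(2 \<epsilon> \<xi>, \<epsilon> \<xi>\<^sup>2)\<close> in the second, whence
  \<open>K = 2 \<epsilon> \<xi>\<close> and \<open>K = \<epsilon> \<xi>\<^sup>2\<close>, with \<open>K' = G\<close> in both cases. At \<open>\<xi> = u\<^sub>l\<close> and \<open>\<xi> = u\<^sub>r\<close> the velocity
  is continuous and equal to the speed of the jump, so the densities cancel from the
  Rankine-Hugoniot conditions. This computation also covers \<open>\<epsilon> = 0\<close>, where the
  perturbed system is the zero-pressure system and the constant density solution is the vacuum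
  solution.\<close>

section \<open>Test functions\<close>

text \<open>A compact subset of the open half plane stays away from the line \<open>t = 0\<close>. This is what
  keeps \<open>x / t\<close> bounded on the support.\<close>

lemma test_functionE:
  assumes "test_function \<phi>"
  obtains a R where "0 < a" "0 < R"
    "\<And>p. \<phi> differentiable (at p)"
    "continuous_on UNIV (dt \<phi>)" "continuous_on UNIV (dx \<phi>)"
    "\<And>t x. t \<le> a \<or> R \<le> t \<or> R \<le> \<bar>x\<bar> \<Longrightarrow>
       \<phi> (t, x) = 0 \<and> dt \<phi> (t, x) = 0 \<and> dx \<phi> (t, x) = 0"
proof -
  define K where "K = closure {p. \<phi> p \<noteq> 0}"
  have K: "compact K" "K \<subseteq> upper_half_plane" and C: "C_k (Suc 0) \<phi>"
    using assms unfolding test_function_def K_def by blast+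
  have diff: "\<phi> differentiable (at p)" for p
    using C by (metis C_k.simps(2))
  have cont: "continuous_on UNIV (dt \<phi>)" "continuous_on UNIV (dx \<phi>)"
    using C unfolding dt_def [abs_def] dx_def [abs_def] by (simp_all only: C_k.simps)
  have off: "\<phi> p = 0 \<and> dt \<phi> p = 0 \<and> dx \<phi> p = 0" if "p \<notin> K" for p
  proof -
    have zero: "\<phi> q = 0" if "q \<in> - K" for q
      using that closure_subset [of "{p. \<phi> p \<noteq> 0}"] unfolding K_def by auto
    have "open (- K)"
      unfolding K_def by (intro open_Compl closed_closure)
    then have "(\<phi> has_derivative (\<lambda>_. 0)) (at p)"
      by (rule has_derivative_transform_within_open [OF has_derivative_const])
        (use that zero in simp_all)
    from frechet_derivative_at [OF this] have "frechet_derivative \<phi> (at p) = (\<lambda>_. 0)"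
      by (rule sym)
    then show ?thesis
      using zero that unfolding dt_def dx_def by simp
  qed
  obtain m where m: "0 < m" "\<And>p. p \<in> K \<Longrightarrow> m \<le> fst p"
  proof (cases "K = {}")
    case True
    then show ?thesis using that [of 1] by simp
  next
    case False
    then obtain q where "q \<in> K" "\<And>p. p \<in> K \<Longrightarrow> fst q \<le> fst p"
      using continuous_attains_inf [OF K(1) _ continuous_on_fst [OF continuous_on_id]] by blast
    moreover from this have "0 < fst q"
      using K(2) by (auto simp: mem_Times_iff)
    ultimately show ?thesis using that by blast
  qed
  obtain R where R: "0 < R" "\<And>p. p \<in> K \<Longrightarrow> norm p < R"
    using compact_imp_bounded [OF K(1)] bounded_pos_less by metis
  have out: "(t, x) \<notin> K" if "t \<le> m / 2 \<or> R \<le> t \<or> R \<le> \<bar>x\<bar>" for t x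
  proof
    assume *: "(t, x) \<in> K"
    have "\<bar>t\<bar> \<le> norm (t, x)" "\<bar>x\<bar> \<le> norm (t, x)"
      using norm_fst_le [of t x] norm_snd_le [of x t] by simp_all
    moreover have "m \<le> t"
      using m(2) [OF *] by simp
    ultimately show False
      using that m(1) R(2) [OF *] by linarith
  qed
  show thesis
  proof (rule that)
    show "0 < m / 2"
      using m(1) by simp
    show "\<phi> (t, x) = 0 \<and> dt \<phi> (t, x) = 0 \<and> dx \<phi> (t, x) = 0"
      if "t \<le> m / 2 \<or> R \<le> t \<or> R \<le> \<bar>x\<bar>" for t x
      using off [OF out [OF that]] .
  qed (fact R(1) diff cont)+
qed

lemma has_derivative_along_curve:
  fixes \<alpha> \<beta> :: "real \<Rightarrow> real"
  assumes "\<phi> differentiable (at (\<alpha> s, \<beta> s))"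
    and "(\<alpha> has_real_derivative \<alpha>') (at s)" "(\<beta> has_real_derivative \<beta>') (at s)"
  shows "((\<lambda>s. \<phi> (\<alpha> s, \<beta> s)) has_real_derivative
           dt \<phi> (\<alpha> s, \<beta> s) * \<alpha>' + dx \<phi> (\<alpha> s, \<beta> s) * \<beta>') (at s)"
proof -
  let ?D = "frechet_derivative \<phi> (at (\<alpha> s, \<beta> s))"
  have D: "(\<phi> has_derivative ?D) (at (\<alpha> s, \<beta> s))"
    using assms(1) frechet_derivative_works by blast
  have "((\<lambda>s. (\<alpha> s, \<beta> s)) has_derivative (\<lambda>h. (\<alpha>' * h, \<beta>' * h))) (at s)"
    using assms(2,3) unfolding has_field_derivative_def by (intro has_derivative_Pair)
  from has_derivative_compose [OF this D]
  have *: "((\<lambda>s. \<phi> (\<alpha> s, \<beta> s)) has_derivative (\<lambda>h. ?D (\<alpha>' * h, \<beta>' * h))) (at s)" .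
  interpret linear ?D
    using D has_derivative_linear by blast
  have "?D (\<alpha>' * h, \<beta>' * h) = (dt \<phi> (\<alpha> s, \<beta> s) * \<alpha>' + dx \<phi> (\<alpha> s, \<beta> s) * \<beta>') * h" for h
  proof -
    have "(\<alpha>' * h, \<beta>' * h) = (\<alpha>' * h) *\<^sub>R (1, 0) + (\<beta>' * h) *\<^sub>R (0, 1 :: real)"
      by simp
    then show ?thesis
      unfolding dt_def dx_def by (simp only: add scale) (simp add: algebra_simps)
  qed
  then show ?thesis
    using * unfolding has_field_derivative_def by simp
qed

section \<open>Locally bounded functions and their integrals\<close>

text \<open>The profiles jump, so continuity cannot give integrability against test functions;
  this notion is closed under the operations that occur and holds for piecewise continuous
  profiles.\<close>

definition locally_bounded :: "('a::euclidean_space \<Rightarrow> real) \<Rightarrow> bool" where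
  "locally_bounded f \<longleftrightarrow> (\<forall>A. bounded A \<longrightarrow> bounded (f ` A))"

lemma bounded_image_continuous:
  fixes f :: "'a::heine_borel \<Rightarrow> 'b::metric_space"
  assumes "continuous_on UNIV f" "bounded A"
  shows "bounded (f ` A)"
proof -
  have "compact (f ` closure A)"
    using assms by (intro compact_continuous_image continuous_on_subset [OF assms(1)]) auto
  then show ?thesis
    by (meson bounded_subset closure_subset compact_imp_bounded image_mono)
qed

lemma locally_bounded_continuous: "continuous_on UNIV f \<Longrightarrow> locally_bounded f"
  unfolding locally_bounded_def by (simp add: bounded_image_continuous)

lemma locally_bounded_compose:
  assumes "locally_bounded W" "continuous_on UNIV h"
  shows "locally_bounded (\<lambda>p. W (h p))"
  using assms(1) bounded_image_continuous [OF assms(2)]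
  unfolding locally_bounded_def by (metis image_image)

lemma locally_bounded_mult:
  assumes "locally_bounded f" "locally_bounded g"
  shows "locally_bounded (\<lambda>x. f x * g x)"
  unfolding locally_bounded_def
proof (intro allI impI)
  fix A :: "'a set"
  assume "bounded A"
  then obtain B C where "\<And>x. x \<in> A \<Longrightarrow> \<bar>f x\<bar> \<le> B" "\<And>x. x \<in> A \<Longrightarrow> \<bar>g x\<bar> \<le> C"
    using assms unfolding locally_bounded_def bounded_iff by (metis image_eqI real_norm_def)
  then have "\<bar>f x * g x\<bar> \<le> B * C" if "x \<in> A" for x
    unfolding abs_mult using that by (meson abs_ge_zero mult_mono order_trans)
  then show "bounded ((\<lambda>x. f x * g x) ` A)"
    unfolding bounded_iff by auto
qed

lemma locally_bounded_add:
  assumes "locally_bounded f" "locally_bounded g"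
  shows "locally_bounded (\<lambda>x. f x + g x)"
  using assms unfolding locally_bounded_def by (blast intro: bounded_plus_comp)

lemma locally_bounded_diff:
  assumes "locally_bounded f" "locally_bounded g"
  shows "locally_bounded (\<lambda>x. f x - g x)"
  using assms unfolding locally_bounded_def by (blast intro: bounded_minus_comp)

lemma integrable_locally_bounded:
  fixes f :: "'a::euclidean_space \<Rightarrow> real"
  assumes f: "f \<in> borel_measurable borel" "locally_bounded f"
    and A: "bounded A" "\<And>x. x \<notin> A \<Longrightarrow> f x = 0"
  shows "integrable lborel f"
proof -
  have "bounded (f ` closure A)"
    using f(2) bounded_closure [OF A(1)] unfolding locally_bounded_def by blast
  then obtain B where B: "\<And>x. x \<in> closure A \<Longrightarrow> \<bar>f x\<bar> \<le> B"
    unfolding bounded_iff by auto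
  show ?thesis
  proof (rule integrableI_bounded_set [where A = "closure A" and B = B])
    show "emeasure lborel (closure A) < \<infinity>"
      using emeasure_bounded_finite [OF bounded_closure [OF A(1)]] .
    show "AE x in lborel. x \<notin> closure A \<longrightarrow> f x = 0"
      using A(2) closure_subset [of A] by auto
  qed (use f B in auto)
qed

text \<open>This is the only integration by parts that is used, once in \<open>\<xi>\<close> and once in \<open>t\<close>. The
  exceptional set \<open>S\<close> allows \<open>f\<close> to jump as long as its primitive \<open>P\<close> is continuous.\<close>

lemma integral_compactly_supported_derivative:
  fixes f P :: "real \<Rightarrow> real"
  assumes "integrable lborel f" "continuous_on UNIV P" "finite S" "0 < M"
    and deriv: "\<And>x. x \<notin> S \<Longrightarrow> (P has_real_derivative f x) (at x)"
    and P0: "\<And>x. M \<le> \<bar>x\<bar> \<Longrightarrow> P x = 0" and f0: "\<And>x. M \<le> \<bar>x\<bar> \<Longrightarrow> f x = 0"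
  shows "(LINT x|lborel. f x) = 0"
proof -
  have "(f has_integral (P M - P (- M))) {-M..M}"
  proof (rule fundamental_theorem_of_calculus_strong [OF assms(3)])
    show "(P has_vector_derivative f x) (at x)" if "x \<in> {-M..M} - S" for x
      using deriv that by (simp add: has_real_derivative_iff_has_vector_derivative)
  qed (use assms(2,4) in \<open>auto intro: continuous_on_subset\<close>)
  then have "(f has_integral 0) {-M..M}"
    using P0 assms(4) by simp
  then have "(f has_integral 0) UNIV"
    by (rule has_integral_on_superset) (auto intro!: f0)
  moreover have "(f has_integral (LINT x|lborel. f x)) UNIV"
    using has_integral_integral_lborel [OF assms(1)] .
  ultimately show ?thesis
    using has_integral_unique by blast
qed



section \<open>Self-similar solutions of conservation laws\<close>

lemma self_similar_apply: "self_similar W (t, x) = W (x / t)"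
  by (simp add: self_similar_def)

lemma borel_measurable_self_similar [measurable]:
  assumes [measurable]: "W \<in> borel_measurable borel"
  shows "self_similar W \<in> borel_measurable borel"
proof -
  have "self_similar W = (\<lambda>p. W (snd p / fst p))"
    by (auto simp: self_similar_def)
  then show ?thesis
    by (simp flip: borel_prod)
qed

lemma locally_integrable_self_similar:
  assumes [measurable]: "W \<in> borel_measurable borel" and bdd: "locally_bounded W"
  shows "locally_integrable (self_similar W)"
  unfolding locally_integrable_def
proof (intro allI impI, elim conjE)
  fix K :: "(real \<times> real) set"
  assume K: "compact K" "K \<subseteq> upper_half_plane"
  have K_meas: "K \<in> sets borel"
    using K by (simp add: borel_compact)
  have "compact ((\<lambda>p. snd p / fst p) ` K)"
    using K by (intro compact_continuous_image continuous_intros) auto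
  then have "bounded (W ` (\<lambda>p. snd p / fst p) ` K)"
    using bdd compact_imp_bounded unfolding locally_bounded_def by blast
  then obtain B where B: "\<And>p. p \<in> K \<Longrightarrow> \<bar>W (snd p / fst p)\<bar> \<le> B"
    unfolding bounded_iff by auto
  then have "\<bar>self_similar W p\<bar> \<le> B" if "p \<in> K" for p
    using that by (simp add: self_similar_def case_prod_beta)
  then show "set_integrable lborel K (self_similar W)"
    unfolding set_integrable_def
    by (intro integrableI_bounded_set_indicator [where B = B])
      (use K_meas emeasure_bounded_finite [OF compact_imp_bounded [OF K(1)]] in auto)
qed

text \<open>Continuity of \<open>\<xi> G(\<xi>) - F(\<xi>)\<close> is the Rankine-Hugoniot condition at every point, and
  the derivative condition is \<open>F' = \<xi> G'\<close> where the profiles are smooth.\<close>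

theorem conservation_law_self_similar:
  fixes G F :: "real \<Rightarrow> real"
  assumes [measurable]: "G \<in> borel_measurable borel" and Gb: "locally_bounded G"
    and cont: "continuous_on UNIV (\<lambda>\<xi>. \<xi> * G \<xi> - F \<xi>)"
    and "finite S"
    and deriv: "\<And>\<xi>. \<xi> \<notin> S \<Longrightarrow> ((\<lambda>\<xi>. \<xi> * G \<xi> - F \<xi>) has_real_derivative G \<xi>) (at \<xi>)"
  shows "conservation_law (self_similar G) (self_similar F)"
proof -
  define K where "K = (\<lambda>\<xi>. \<xi> * G \<xi> - F \<xi>)"
  have contK: "continuous_on UNIV K"
    using cont unfolding K_def .
  then have K_meas [measurable]: "K \<in> borel_measurable borel"
    by (rule borel_measurable_continuous_onI)
  have F_eq: "F = (\<lambda>\<xi>. \<xi> * G \<xi> - K \<xi>)"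
    unfolding K_def by simp
  have F_meas [measurable]: "F \<in> borel_measurable borel"
    unfolding F_eq by simp
  have Fb: "locally_bounded F"
    unfolding F_eq
    by (intro locally_bounded_diff locally_bounded_mult locally_bounded_continuous [OF contK]
          locally_bounded_continuous Gb continuous_intros)
  have "(LINT p:upper_half_plane|lborel. self_similar G p * dt \<phi> p + self_similar F p * dx \<phi> p) = 0"
    if test: "test_function \<phi>" for \<phi>
  proof -
    obtain a R where aR: "0 < a" "0 < R" and diff: "\<And>p. \<phi> differentiable (at p)"
      and cdt: "continuous_on UNIV (dt \<phi>)" and cdx: "continuous_on UNIV (dx \<phi>)"
      and out: "\<And>t x. t \<le> a \<or> R \<le> t \<or> R \<le> \<bar>x\<bar> \<Longrightarrow>
           \<phi> (t, x) = 0 \<and> dt \<phi> (t, x) = 0 \<and> dx \<phi> (t, x) = 0"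
      using test_functionE [OF test] by blast
    have c\<phi>: "continuous_on UNIV \<phi>"
      using diff by (meson continuous_at_imp_continuous_on differentiable_imp_continuous_within)
    note [continuous_intros] = continuous_on_compose2 [OF c\<phi>]
      continuous_on_compose2 [OF cdt] continuous_on_compose2 [OF cdx]
    note [measurable] = borel_measurable_continuous_onI [OF c\<phi>]
      borel_measurable_continuous_onI [OF cdt] borel_measurable_continuous_onI [OF cdx]
    \<comment> \<open>In the coordinates \<open>(t, \<xi>)\<close> the support lies in \<open>a \<le> t \<le> R\<close>, \<open>\<bar>\<xi>\<bar> \<le> R / a\<close>.\<close>
    define M where "M = R / a"
    have M: "0 < M" unfolding M_def using aR by simp
    have out': "\<phi> (t, t * \<xi>) = 0 \<and> dt \<phi> (t, t * \<xi>) = 0 \<and> dx \<phi> (t, t * \<xi>) = 0"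
      if "t \<le> a \<or> R \<le> t \<or> M \<le> \<bar>\<xi>\<bar>" for t \<xi>
    proof -
      have "R \<le> \<bar>t * \<xi>\<bar>" if "a < t" "M \<le> \<bar>\<xi>\<bar>"
      proof -
        have "a * M \<le> t * \<bar>\<xi>\<bar>"
          using that aR M by (intro mult_mono) auto
        then show ?thesis
          using that aR unfolding M_def by (simp add: abs_mult)
      qed
      then show ?thesis
        using out that by (meson not_le)
    qed

    define I where "I = (\<lambda>p. self_similar G p * dt \<phi> p + self_similar F p * dx \<phi> p)"
    \<comment> \<open>\<open>D\<close> is \<open>(t \<psi>)\<^sub>t\<close> for \<open>\<psi>(t, \<xi>) = \<phi>(t, t \<xi>)\<close>.\<close>
    define D where "D = (\<lambda>p. \<phi> (fst p, fst p * snd p) +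
      fst p * (dt \<phi> (fst p, fst p * snd p) + snd p * dx \<phi> (fst p, fst p * snd p)))"
    define J where "J = (\<lambda>p. G (snd p) * D p)"
    have contD: "continuous_on UNIV D"
      unfolding D_def by (intro continuous_intros) auto
    have D_out: "D (t, \<xi>) = 0" if "t \<le> a \<or> R \<le> t \<or> M \<le> \<bar>\<xi>\<bar>" for t \<xi>
      unfolding D_def using out' [OF that] by simp

    have box: "fst p \<le> a \<or> R \<le> fst p \<or> X \<le> \<bar>snd p\<bar>" if "p \<notin> {a..R} \<times> {-X..X}" for p and X :: real
      using that by (cases p) auto
    have int_I: "integrable lborel I"
    proof (rule integrable_locally_bounded [where A = "{a..R} \<times> {-R..R}"])
      show "I \<in> borel_measurable borel"
        unfolding I_def by simp
      \<comment> \<open>Replacing \<open>t\<close> by \<open>max a t\<close> changes nothing on the support and makes the argument of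
        the profiles continuous on the whole plane.\<close>
      have "I = (\<lambda>p. G (snd p / max a (fst p)) * dt \<phi> p + F (snd p / max a (fst p)) * dx \<phi> p)"
      proof
        fix p
        show "I p = G (snd p / max a (fst p)) * dt \<phi> p + F (snd p / max a (fst p)) * dx \<phi> p"
          using out [of "fst p" "snd p"] unfolding I_def
          by (cases "fst p \<le> a") (auto simp: self_similar_def case_prod_beta max_def)
      qed
      moreover have "continuous_on UNIV (\<lambda>p :: real \<times> real. snd p / max a (fst p))"
        using aR by (intro continuous_intros) auto
      ultimately show "locally_bounded I"
        by (simp only:) (intro locally_bounded_add locally_bounded_mult
            locally_bounded_compose [OF Gb] locally_bounded_compose [OF Fb]
            locally_bounded_continuous cdt cdx)
      fix p assume "p \<notin> {a..R} \<times> {-R..R}"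
      then show "I p = 0"
        using out [of "fst p" "snd p"] box [of p R] unfolding I_def by simp
    qed (intro bounded_Times bounded_closed_interval)

    have int_J: "integrable lborel J"
    proof (rule integrable_locally_bounded [where A = "{a..R} \<times> {-M..M}"])
      show "J \<in> borel_measurable borel"
        unfolding J_def using borel_measurable_continuous_onI [OF contD] by (simp flip: borel_prod)
      show "locally_bounded J"
        unfolding J_def
        by (intro locally_bounded_mult locally_bounded_continuous contD locally_bounded_compose [OF Gb]
                continuous_intros)
      fix p assume "p \<notin> {a..R} \<times> {-M..M}"
      then show "J p = 0"
        using D_out [of "fst p" "snd p"] box [of p M] unfolding J_def by simp
    qed (intro bounded_Times bounded_closed_interval)

    \<comment> \<open>The two inner integrands differ, after the substitution \<open>x = t \<xi>\<close>, by \<open>E = (K \<psi>)\<^sub>\<xi>\<close>.\<close>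
    have slice: "(LINT x|lborel. I (t, x)) = (LINT \<xi>|lborel. J (t, \<xi>))" for t
    proof (cases "a < t")
      case False
      then show ?thesis
        using out D_out unfolding I_def J_def by simp
    next
      case True
      then have t: "0 < t"
        using aR by auto
      have outside: "M \<le> \<bar>\<xi>\<bar>" if "\<xi> \<notin> {-M..M}" for \<xi>
        using that by auto
      define E where "E = (\<lambda>\<xi>. G \<xi> * \<phi> (t, t * \<xi>) + K \<xi> * (t * dx \<phi> (t, t * \<xi>)))"
      have int_E: "integrable lborel E"
      proof (rule integrable_locally_bounded [where A = "{-M..M}"])
        show "E \<in> borel_measurable borel"
          unfolding E_def by (simp flip: borel_prod)
        show "locally_bounded E"
          unfolding E_def
          by (intro locally_bounded_add locally_bounded_mult [OF Gb] locally_bounded_continuous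
                continuous_intros contK) auto
        fix \<xi> assume "\<xi> \<notin> {-M..M}"
        then show "E \<xi> = 0"
          unfolding E_def using out' [of t \<xi>] outside by simp
      qed auto
      have "(LINT \<xi>|lborel. E \<xi>) = 0"
      proof (rule integral_compactly_supported_derivative [OF int_E _ \<open>finite S\<close> M])
        show "continuous_on UNIV (\<lambda>\<xi>. K \<xi> * \<phi> (t, t * \<xi>))"
          by (intro continuous_intros contK) auto
        fix \<xi>
        have "((\<lambda>\<xi>. t * \<xi>) has_real_derivative t) (at \<xi>)"
          by (auto intro!: derivative_eq_intros)
        from has_derivative_along_curve [where \<alpha> = "\<lambda>_. t", OF diff DERIV_const this]
        have "((\<lambda>\<xi>. \<phi> (t, t * \<xi>)) has_real_derivative dx \<phi> (t, t * \<xi>) * t) (at \<xi>)"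
          by simp
        moreover assume "\<xi> \<notin> S"
        ultimately show "((\<lambda>\<xi>. K \<xi> * \<phi> (t, t * \<xi>)) has_real_derivative E \<xi>) (at \<xi>)"
          unfolding E_def using deriv [of \<xi>] unfolding K_def [symmetric]
          by (auto intro!: derivative_eq_intros)
      qed (use out' in \<open>auto simp: E_def\<close>)
      moreover have "integrable lborel (\<lambda>\<xi>. J (t, \<xi>))"
      proof (rule integrable_locally_bounded [where A = "{-M..M}"])
        have c: "continuous_on UNIV (\<lambda>\<xi>. D (t, \<xi>))"
          by (intro continuous_on_compose2 [OF contD] continuous_intros) auto
        show "(\<lambda>\<xi>. J (t, \<xi>)) \<in> borel_measurable borel"
          unfolding J_def using borel_measurable_continuous_onI [OF c] by simp
        show "locally_bounded (\<lambda>\<xi>. J (t, \<xi>))"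
          unfolding J_def snd_conv by (intro locally_bounded_mult locally_bounded_continuous Gb c)
        fix \<xi> assume "\<xi> \<notin> {-M..M}"
        then show "J (t, \<xi>) = 0"
          using D_out [of t \<xi>] outside unfolding J_def by simp
      qed auto
      ultimately have "(LINT \<xi>|lborel. J (t, \<xi>)) = (LINT \<xi>|lborel. J (t, \<xi>) - E \<xi>)"
        using int_E by simp
      also have "\<dots> = (LINT \<xi>|lborel. t * I (t, t * \<xi>))"
        unfolding J_def D_def E_def I_def F_eq self_similar_apply using t
        by (intro Bochner_Integration.integral_cong) (auto simp: algebra_simps)
      also have "\<dots> = (LINT x|lborel. I (t, x))"
        using lborel_integral_real_affine [of t "\<lambda>x. I (t, x)" 0] t by simp
      finally show ?thesis ..
    qed

    have time: "(LINT t|lborel. D (t, \<xi>)) = 0" for \<xi>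
    proof (rule integral_compactly_supported_derivative [of _ "\<lambda>t. t * \<phi> (t, t * \<xi>)" "{}" R])
      have c: "continuous_on UNIV (\<lambda>t. D (t, \<xi>))"
        by (intro continuous_on_compose2 [OF contD] continuous_intros) auto
      show "integrable lborel (\<lambda>t. D (t, \<xi>))"
      proof (rule integrable_locally_bounded [where A = "{a..R}"])
        fix t assume "t \<notin> {a..R}"
        then show "D (t, \<xi>) = 0"
          using D_out by auto
      qed (auto intro: borel_measurable_continuous_onI c locally_bounded_continuous)
      show "continuous_on UNIV (\<lambda>t. t * \<phi> (t, t * \<xi>))"
        by (intro continuous_intros) auto
      fix t
      have "((\<lambda>t. t * \<xi>) has_real_derivative \<xi>) (at t)"
        by (auto intro!: derivative_eq_intros)
      from has_derivative_along_curve [where \<alpha> = "\<lambda>t. t", OF diff DERIV_ident this]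
      have "((\<lambda>t. \<phi> (t, t * \<xi>)) has_real_derivative
          dt \<phi> (t, t * \<xi>) + dx \<phi> (t, t * \<xi>) * \<xi>) (at t)"
        by simp
      then show "((\<lambda>t. t * \<phi> (t, t * \<xi>)) has_real_derivative D (t, \<xi>)) (at t)"
        unfolding D_def by (auto intro!: derivative_eq_intros)
    qed (use aR out' D_out in \<open>auto simp: abs_if split: if_splits\<close>)

    have "(LINT p:upper_half_plane|lborel. I p) = (LINT p|lborel. I p)"
      unfolding set_lebesgue_integral_def
    proof (intro Bochner_Integration.integral_cong refl)
      fix p :: "real \<times> real"
      show "indicat_real upper_half_plane p *\<^sub>R I p = I p"
        using out [of "fst p" "snd p"] aR unfolding I_def by (cases p) (auto simp: indicator_def)
    qed
    also have "\<dots> = (LINT t|lborel. LINT x|lborel. I (t, x))"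
      using lborel_pair.integral_fst' [of I] int_I by (simp add: lborel_prod)
    also have "\<dots> = (LINT t|lborel. LINT \<xi>|lborel. J (t, \<xi>))"
      by (simp only: slice)
    also have "\<dots> = (LINT \<xi>|lborel. LINT t|lborel. J (t, \<xi>))"
      using lborel_pair.Fubini_integral [of "\<lambda>t \<xi>. J (t, \<xi>)"] int_J by (simp add: lborel_prod)
    also have "\<dots> = 0"
      unfolding J_def using time by simp
    finally show ?thesis
      unfolding I_def .
  qed
  then show ?thesis
    unfolding conservation_law_def
    by (auto intro: locally_integrable_self_similar Gb Fb)
qed


text \<open>For fixed \<open>x \<noteq> 0\<close> the similarity variable \<open>x / t\<close> leaves every bounded interval as
  \<open>t\<close> decreases to \<open>0\<close>.\<close>

lemma riemann_data_self_similar: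
  assumes "\<And>\<xi>. \<xi> < a \<Longrightarrow> W \<xi> = w\<^sub>l" "\<And>\<xi>. b < \<xi> \<Longrightarrow> W \<xi> = w\<^sub>r"
  shows "riemann_data (self_similar W) w\<^sub>l w\<^sub>r"
  unfolding riemann_data_def self_similar_apply
proof (intro conjI allI impI)
  fix x :: real
  assume "x < 0"
  then have "filterlim (\<lambda>t. x * inverse t) at_bot (at_right 0)"
    by (intro filterlim_tendsto_neg_mult_at_bot [OF tendsto_const]
          filterlim_inverse_at_top_right)
  then have "eventually (\<lambda>t. x / t < a) (at_right 0)"
    unfolding filterlim_at_bot_dense by (simp add: divide_inverse)
  then show "((\<lambda>t. W (x / t)) \<longlongrightarrow> w\<^sub>l) (at_right 0)"
    by (rule tendsto_eventually [OF eventually_mono]) (rule assms(1))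
next
  fix x :: real
  assume "0 < x"
  then have "filterlim (\<lambda>t. x * inverse t) at_top (at_right 0)"
    by (intro filterlim_tendsto_pos_mult_at_top [OF tendsto_const]
          filterlim_inverse_at_top_right)
  then have "eventually (\<lambda>t. b < x / t) (at_right 0)"
    unfolding filterlim_at_top_dense by (simp add: divide_inverse)
  then show "((\<lambda>t. W (x / t)) \<longlongrightarrow> w\<^sub>r) (at_right 0)"
    by (rule tendsto_eventually [OF eventually_mono]) (rule assms(2))
qed

section \<open>Profiles with two jumps\<close>

definition three_piece ::
    "real \<Rightarrow> real \<Rightarrow> (real \<Rightarrow> real) \<Rightarrow> (real \<Rightarrow> real) \<Rightarrow> (real \<Rightarrow> real) \<Rightarrow> real \<Rightarrow> real" where
  "three_piece a b L C R \<xi> = (if \<xi> < a then L \<xi> else if \<xi> \<le> b then C \<xi> else R \<xi>)"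

lemma borel_measurable_three_piece:
  assumes [measurable]: "L \<in> borel_measurable borel" "C \<in> borel_measurable borel"
    "R \<in> borel_measurable borel"
  shows "three_piece a b L C R \<in> borel_measurable borel"
  unfolding three_piece_def [abs_def] by measurable

lemma locally_bounded_three_piece:
  assumes "locally_bounded L" "locally_bounded C" "locally_bounded R"
  shows "locally_bounded (three_piece a b L C R)"
  unfolding locally_bounded_def
proof (intro allI impI)
  fix A :: "real set"
  assume "bounded A"
  then have "bounded (L ` A \<union> C ` A \<union> R ` A)"
    using assms unfolding locally_bounded_def by simp
  then show "bounded (three_piece a b L C R ` A)"
    by (rule bounded_subset) (auto simp: three_piece_def)
qed

lemma continuous_on_three_piece:
  assumes "a \<le> b" "L a = C a" "C b = R b"
    and "continuous_on UNIV L" "continuous_on UNIV C" "continuous_on UNIV R"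
  shows "continuous_on UNIV (three_piece a b L C R)"
proof -
  have 1: "continuous_on ({..b} \<union> {b..}) (\<lambda>\<xi>. if \<xi> \<le> b then C \<xi> else R \<xi>)"
    using assms by (intro continuous_on_cases) (auto intro: continuous_on_subset)
  have "continuous_on ({..a} \<union> {a..})
      (\<lambda>\<xi>. if \<xi> \<le> a then L \<xi> else if \<xi> \<le> b then C \<xi> else R \<xi>)"
    using assms by (intro continuous_on_cases continuous_on_subset [OF 1])
      (auto intro: continuous_on_subset)
  moreover have "{..a} \<union> {a..} = UNIV"
    by auto
  moreover have "three_piece a b L C R =
      (\<lambda>\<xi>. if \<xi> \<le> a then L \<xi> else if \<xi> \<le> b then C \<xi> else R \<xi>)"
    using assms by (auto simp: three_piece_def)
  ultimately show ?thesis by simp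
qed

lemma has_real_derivative_three_piece:
  assumes "a \<le> b" "\<xi> \<notin> {a, b}"
    and "(L has_real_derivative L' \<xi>) (at \<xi>)" "(C has_real_derivative C' \<xi>) (at \<xi>)"
      "(R has_real_derivative R' \<xi>) (at \<xi>)"
  shows "(three_piece a b L C R has_real_derivative three_piece a b L' C' R' \<xi>) (at \<xi>)"
proof -
  consider "\<xi> < a" | "a < \<xi>" "\<xi> < b" | "b < \<xi>"
    using assms(2) by fastforce
  then show ?thesis
  proof cases
    case 1
    then show ?thesis
      using has_field_derivative_transform_within_open [OF assms(3), of "{..<a}"]
      by (simp add: three_piece_def)
  next
    case 2
    then show ?thesis
      using has_field_derivative_transform_within_open [OF assms(4), of "{a<..<b}"]
      by (simp add: three_piece_def)
  next
    case 3
    then show ?thesis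
      using has_field_derivative_transform_within_open [OF assms(5), of "{b<..}"] assms(1)
      by (simp add: three_piece_def)
  qed
qed

text \<open>The assumptions \<open>jump\<close> are the Rankine-Hugoniot conditions for jumps from the outer
  constant states to the inner profile with speeds \<open>a\<close> and \<open>b\<close>.\<close>

lemma conservation_law_three_piece:
  assumes "a \<le> b"
    and C: "\<And>\<xi>. ((\<lambda>\<xi>. \<xi> * C \<xi> - C\<^sub>F \<xi>) has_real_derivative C \<xi>) (at \<xi>)" "continuous_on UNIV C"
    and jump: "f\<^sub>l - C\<^sub>F a = a * (g\<^sub>l - C a)" "f\<^sub>r - C\<^sub>F b = b * (g\<^sub>r - C b)"
  shows "conservation_law (self_similar (three_piece a b (\<lambda>_. g\<^sub>l) C (\<lambda>_. g\<^sub>r)))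
           (self_similar (three_piece a b (\<lambda>_. f\<^sub>l) C\<^sub>F (\<lambda>_. f\<^sub>r)))"
proof (rule conservation_law_self_similar [where S = "{a, b}"])
  let ?G = "three_piece a b (\<lambda>_. g\<^sub>l) C (\<lambda>_. g\<^sub>r)" and ?F = "three_piece a b (\<lambda>_. f\<^sub>l) C\<^sub>F (\<lambda>_. f\<^sub>r)"
  have K: "(\<lambda>\<xi>. \<xi> * ?G \<xi> - ?F \<xi>) =
      three_piece a b (\<lambda>\<xi>. \<xi> * g\<^sub>l - f\<^sub>l) (\<lambda>\<xi>. \<xi> * C \<xi> - C\<^sub>F \<xi>) (\<lambda>\<xi>. \<xi> * g\<^sub>r - f\<^sub>r)"
    by (auto simp: three_piece_def)
  show "continuous_on UNIV (\<lambda>\<xi>. \<xi> * ?G \<xi> - ?F \<xi>)"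
    unfolding K using assms(1) jump
    by (intro continuous_on_three_piece DERIV_continuous_on [OF C(1)] continuous_intros)
      (auto simp: algebra_simps)
  show "((\<lambda>\<xi>. \<xi> * ?G \<xi> - ?F \<xi>) has_real_derivative ?G \<xi>) (at \<xi>)" if "\<xi> \<notin> {a, b}" for \<xi>
    unfolding K using assms(1) that C(1)
    by (intro has_real_derivative_three_piece) (auto intro!: derivative_eq_intros)
  show "locally_bounded ?G"
    using C(2) by (intro locally_bounded_three_piece locally_bounded_continuous) auto
  show "?G \<in> borel_measurable borel"
    using C(2) by (intro borel_measurable_three_piece borel_measurable_continuous_onI) auto
qed auto

section \<open>Constant density solutions and the vacuum limit\<close>

text \<open>The parameter \<open>\<epsilon>\<close> ranges over all reals, so that \<open>\<epsilon> = 0\<close> yields the vacuum solution.\<close>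

lemma constant_density_solution_perturbed_system:
  fixes \<rho>\<^sub>l \<rho>\<^sub>r u\<^sub>l u\<^sub>r \<epsilon> :: real
  assumes "u\<^sub>l \<le> u\<^sub>r"
  defines "w \<equiv> constant_density_solution (\<rho>\<^sub>l, u\<^sub>l) (\<rho>\<^sub>r, u\<^sub>r) \<epsilon>"
  shows "riemann_solution (perturbed_system \<epsilon>) (\<rho>\<^sub>l, u\<^sub>l) (\<rho>\<^sub>r, u\<^sub>r) w"
proof -
  let ?\<rho> = "self_similar (\<lambda>\<xi>. fst (w \<xi>))" and ?u = "self_similar (\<lambda>\<xi>. snd (w \<xi>))"
  let ?T = "three_piece u\<^sub>l u\<^sub>r"
  have mass: "(\<lambda>\<xi>. fst (w \<xi>)) = ?T (\<lambda>_. \<rho>\<^sub>l) (\<lambda>_. 2 * \<epsilon>) (\<lambda>_. \<rho>\<^sub>r)"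
    "(\<lambda>\<xi>. fst (w \<xi>) * snd (w \<xi>) - 2 * \<epsilon> * snd (w \<xi>)) =
       ?T (\<lambda>_. \<rho>\<^sub>l * u\<^sub>l - 2 * \<epsilon> * u\<^sub>l) (\<lambda>_. 0) (\<lambda>_. \<rho>\<^sub>r * u\<^sub>r - 2 * \<epsilon> * u\<^sub>r)"
   and momentum: "(\<lambda>\<xi>. fst (w \<xi>) * snd (w \<xi>)) =
       ?T (\<lambda>_. \<rho>\<^sub>l * u\<^sub>l) (\<lambda>\<xi>. 2 * \<epsilon> * \<xi>) (\<lambda>_. \<rho>\<^sub>r * u\<^sub>r)"
    "(\<lambda>\<xi>. fst (w \<xi>) * (snd (w \<xi>))\<^sup>2 - \<epsilon> * (snd (w \<xi>))\<^sup>2) =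
       ?T (\<lambda>_. \<rho>\<^sub>l * u\<^sub>l\<^sup>2 - \<epsilon> * u\<^sub>l\<^sup>2) (\<lambda>\<xi>. \<epsilon> * \<xi>\<^sup>2) (\<lambda>_. \<rho>\<^sub>r * u\<^sub>r\<^sup>2 - \<epsilon> * u\<^sub>r\<^sup>2)"
    unfolding w_def by (simp_all add: fun_eq_iff three_piece_def constant_density_solution_def)
  have mass_flux: "(\<lambda>p. ?\<rho> p * ?u p - 2 * \<epsilon> * ?u p) =
      self_similar (\<lambda>\<xi>. fst (w \<xi>) * snd (w \<xi>) - 2 * \<epsilon> * snd (w \<xi>))"
    and momentum_eq: "(\<lambda>p. ?\<rho> p * ?u p) = self_similar (\<lambda>\<xi>. fst (w \<xi>) * snd (w \<xi>))"
    and momentum_flux: "(\<lambda>p. ?\<rho> p * (?u p)\<^sup>2 - \<epsilon> * (?u p)\<^sup>2) =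
      self_similar (\<lambda>\<xi>. fst (w \<xi>) * (snd (w \<xi>))\<^sup>2 - \<epsilon> * (snd (w \<xi>))\<^sup>2)"
    by (simp_all add: fun_eq_iff self_similar_def)
  have "conservation_law ?\<rho> (\<lambda>p. ?\<rho> p * ?u p - 2 * \<epsilon> * ?u p)"
    unfolding mass_flux unfolding mass
  proof (rule conservation_law_three_piece [OF assms(1)])
    show "((\<lambda>\<xi>. \<xi> * (2 * \<epsilon>) - 0) has_real_derivative 2 * \<epsilon>) (at \<xi>)" for \<xi> :: real
      by (auto intro!: derivative_eq_intros)
  qed (auto simp: algebra_simps)
  moreover have "conservation_law (\<lambda>p. ?\<rho> p * ?u p) (\<lambda>p. ?\<rho> p * (?u p)\<^sup>2 - \<epsilon> * (?u p)\<^sup>2)"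
    unfolding momentum_flux unfolding momentum_eq momentum
  proof (rule conservation_law_three_piece [OF assms(1)])
    show "((\<lambda>\<xi>. \<xi> * (2 * \<epsilon> * \<xi>) - \<epsilon> * \<xi>\<^sup>2) has_real_derivative 2 * \<epsilon> * \<xi>) (at \<xi>)" for \<xi> :: real
      by (auto intro!: derivative_eq_intros)
  qed (auto intro!: continuous_intros simp: algebra_simps power2_eq_square)
  moreover have "riemann_data ?\<rho> \<rho>\<^sub>l \<rho>\<^sub>r" "riemann_data ?u u\<^sub>l u\<^sub>r"
    using assms(1)
    by (intro riemann_data_self_similar [where a = u\<^sub>l and b = u\<^sub>r];
        simp add: w_def constant_density_solution_def)+
  ultimately show ?thesis
    unfolding riemann_solution_def perturbed_system_def Let_def by simp
qed

lemma perturbed_system_0: "perturbed_system 0 = zero_pressure_system"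
  by (simp add: fun_eq_iff perturbed_system_def zero_pressure_system_def)

lemma constant_density_solution_0: "constant_density_solution l r 0 = vacuum_solution l r"
  by (simp add: fun_eq_iff constant_density_solution_def vacuum_solution_def)

lemma constant_density_solution_tendsto:
  "((\<lambda>\<epsilon>. constant_density_solution l r \<epsilon> \<xi>) \<longlongrightarrow> vacuum_solution l r \<xi>) (at_right 0)"
proof -
  have "((\<lambda>\<epsilon>::real. (2 * \<epsilon>, \<xi>)) \<longlongrightarrow> (2 * 0, \<xi>)) (at_right 0)"
    by (intro tendsto_intros)
  then show ?thesis
    unfolding constant_density_solution_def vacuum_solution_def by simp
qed

theorem mainTheorem3:
  fixes \<rho>\<^sub>l \<rho>\<^sub>r u\<^sub>l u\<^sub>r :: real
  assumes "\<rho>\<^sub>l > 0" and "\<rho>\<^sub>r > 0" and "\<rho>\<^sub>l \<noteq> \<rho>\<^sub>r" and "u\<^sub>l < u\<^sub>r"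
  defines "l \<equiv> (\<rho>\<^sub>l, u\<^sub>l)" and "r \<equiv> (\<rho>\<^sub>r, u\<^sub>r)"
  shows "(\<forall>\<epsilon>. 0 < \<epsilon> \<and> 2 * \<epsilon> \<le> \<rho>\<^sub>l \<and> 2 * \<epsilon> \<le> \<rho>\<^sub>r \<longrightarrow>
            riemann_solution (perturbed_system \<epsilon>) l r (constant_density_solution l r \<epsilon>)) \<and>
         (\<forall>\<xi>. ((\<lambda>\<epsilon>. constant_density_solution l r \<epsilon> \<xi>) \<longlongrightarrow> vacuum_solution l r \<xi>) (at_right 0)) \<and>
         riemann_solution zero_pressure_system l r (vacuum_solution l r)"
proof -
  have solution: "riemann_solution (perturbed_system \<epsilon>) l r (constant_density_solution l r \<epsilon>)" for \<epsilon>
    unfolding l_def r_def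
    using constant_density_solution_perturbed_system less_imp_le [OF assms(4)] .
  from solution [of 0] have "riemann_solution zero_pressure_system l r (vacuum_solution l r)"
    by (simp only: perturbed_system_0 constant_density_solution_0)
  with solution show ?thesis
    using constant_density_solution_tendsto by blast
qed

end
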